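(* Declare the open subclasses of $\mathbf{No}$ to be the following: the empty set is open; a nonempty subinterval of $\mathbf{No}$ is open if it (1) has endpoints in $\mathbf{No} \cup \{\mathbf{On}, \mathbf{Off}\}$ and (2) does not contain its endpoints; and a subclass $A \subset \mathbf{No}$ is open if it has the form $A = \bigcup_{i\in I} A_i$, where $I$ is a proper set and the $A_i$ are open intervals. Then this defines a topology on $\mathbf{No}$ (in the sense given in the context).
   Context: $\mathbf{No}$ is the class of surreal numbers; $\mathbf{On}$ and $\mathbf{Off}$ denote here the gaps respectively larger than and smaller than all surreal numbers. "Proper set" means a set as opposed to a proper class. A topology on $\mathbf{No}$ is a collection $\mathcal{A}$ of subclasses of $\mathbf{No}$ (called open) satisfying: (1) $\varnothing, \mathbf{No} \in \mathcal{A}$; (2) $\bigcup_{i \in I} A_i \in \mathcal{A}$ for any subcollection $\{A_i\}_{i \in I} \subset \mathcal{A}$ indexed over a proper set $I$; (3) $\bigcap_{i \in I} A_i \in \mathcal{A}$ for any subcollection $\{A_i\}_{i \in I} \subset \mathcal{A}$ indexed over a finite set $I$. (Unions indexed over proper classes need not be open. Set-theoretically, a collection of classes is to be understood as a labelling of classes, e.g. in NBG.) *)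

theory Defs
  imports "HOL-Library.Extended"
begin

text \<open>
  An instance of the following class is a universe of ZFC sets: its elements are the proper sets,
  and its proper classes are the HOL sets that are not of the form \<open>elts x\<close>. Separation and
  replacement are second-order (\<open>P\<close> and \<open>f\<close> are arbitrary), so a HOL set of elements plays the role
  of a class. Choice, also for families of classes, is inherited from HOL.
\<close>

class zfc =
  fixes elts :: "'a \<Rightarrow> 'a set"
  assumes extensionality: "elts x = elts y \<Longrightarrow> x = y"
    and foundation: "wf {(x, y). x \<in> elts y}"
    and pairing: "\<exists>z. elts z = {x, y}"
    and union: "\<exists>z. elts z = (\<Union>y\<in>elts x. elts y)"
    and power: "\<exists>z. elts z = {y. elts y \<subseteq> elts x}"
    and infinity: "\<exists>w. (\<exists>e\<in>elts w. elts e = {}) \<and>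
                       (\<forall>x\<in>elts w. \<exists>y\<in>elts w. elts y = insert x (elts x))"
    and separation: "\<exists>z. elts z = {y \<in> elts x. P y}"
    and replacement: "\<exists>z. elts z = f ` elts x"

text \<open>
  The surreal numbers follow Conway: \<open>{L | R}\<close> is the Kuratowski pair of the sets \<open>L\<close> and \<open>R\<close>, and
  a number is represented by every such pair naming it. The order \<open>conway_le\<close> is defined on the
  whole universe, where a set that is not a pair has no options, but is only used on numbers.
\<close>

definition set_of :: "'v::zfc set \<Rightarrow> 'v" where
  "set_of X = (THE z. elts z = X)"

definition opair :: "'v::zfc \<Rightarrow> 'v \<Rightarrow> 'v" where
  "opair L R = set_of {set_of {L}, set_of {L, R}}"

lemma elts_set_of_pair [simp]: "elts (set_of {x, y}) = {x, y}"
proof -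
  obtain z where z: "elts z = {x, y}"
    using pairing by blast
  show ?thesis
    unfolding set_of_def by (rule theI[of _ z]) (use z in \<open>auto intro: extensionality\<close>)
qed

lemma elts_set_of_singleton [simp]: "elts (set_of {x}) = {x}"
  using elts_set_of_pair[of x x] by simp

lemma opair_inject [simp]: "opair L R = opair L' R' \<longleftrightarrow> L = L' \<and> R = R'"
proof
  have inj: "set_of {a, b} = set_of {c, d} \<longleftrightarrow> {a, b} = {c, d}" for a b c d :: 'a
    by (metis elts_set_of_pair)
  have inj1: "set_of {a} = set_of {c, d} \<longleftrightarrow> {a} = {c, d}"
    "set_of {c, d} = set_of {a} \<longleftrightarrow> {c, d} = {a}"  "set_of {a} = set_of {c} \<longleftrightarrow> {a} = {c}"
    for a c d :: 'a
    by (metis elts_set_of_pair elts_set_of_singleton)+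
  assume "opair L R = opair L' R'"
  then show "L = L' \<and> R = R'"
    by (auto simp: opair_def inj inj1 doubleton_eq_iff)
qed simp

definition left_opts :: "'v::zfc \<Rightarrow> 'v set" where
  "left_opts x = {l. \<exists>L R. x = opair L R \<and> l \<in> elts L}"

definition right_opts :: "'v::zfc \<Rightarrow> 'v set" where
  "right_opts x = {r. \<exists>L R. x = opair L R \<and> r \<in> elts R}"

lemma left_opts_opair [simp]: "left_opts (opair L R) = elts L"
  and right_opts_opair [simp]: "right_opts (opair L R) = elts R"
  by (auto simp: left_opts_def right_opts_def)

definition option_rel :: "('v::zfc \<times> 'v) set" where
  "option_rel = {(y, x). y \<in> left_opts x \<union> right_opts x}"

lemma left_option_rel: "y \<in> left_opts x \<Longrightarrow> (y, x) \<in> option_rel"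
  and right_option_rel: "y \<in> right_opts x \<Longrightarrow> (y, x) \<in> option_rel"
  by (auto simp: option_rel_def)

lemma wf_option_rel: "wf option_rel"
proof (rule wf_subset[OF wf_trancl[OF foundation]])
  let ?E = "{(x, y :: 'a). x \<in> elts y}"
  have "(l, opair L R) \<in> ?E\<^sup>+" if lr: "l \<in> elts L \<or> l \<in> elts R" for l L R
  proof -
    obtain S where "(l, S) \<in> ?E" and "(S, set_of {L, R}) \<in> ?E"
      using lr by auto
    moreover have "(set_of {L, R}, opair L R) \<in> ?E"
      by (simp add: opair_def)
    ultimately show ?thesis
      by (meson trancl.intros)
  qed
  then show "option_rel \<subseteq> ?E\<^sup>+"
    by (auto simp: option_rel_def left_opts_def right_opts_def)
qed

definition le_call_rel :: "(('v::zfc \<times> 'v) \<times> ('v \<times> 'v)) set" where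
  "le_call_rel = {((y, l), (x, y)) | x y l. l \<in> left_opts x} \<union>
                 {((r, x), (x, y)) | x y r. r \<in> right_opts y}"

lemma wf_le_call_rel: "wf (le_call_rel :: (('v::zfc \<times> 'v) \<times> _) set)"
proof -
  let ?A = "\<lambda>x y :: 'v. (x, y) \<in> Wellfounded.acc le_call_rel"
  have "?A (fst p) (snd p) \<and> ?A (snd p) (fst p)" for p :: "'v \<times> 'v"
  proof (induction p rule: wf_induct_rule[OF wf_lex_prod[OF wf_option_rel wf_option_rel]])
    case (1 p)
    obtain x y where p: "p = (x, y)"
      by (cases p)
    have a: "?A y l \<and> ?A l y" if "(l, x) \<in> option_rel" for l
      using 1[of "(l, y)"] that by (simp add: p)
    have b: "?A x r \<and> ?A r x" if "(r, y) \<in> option_rel" for r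
      using 1[of "(x, r)"] that by (simp add: p)
    have "?A x y"
      by (rule accI) (use a b in \<open>auto simp: le_call_rel_def option_rel_def\<close>)
    moreover have "?A y x"
      by (rule accI) (use a b in \<open>auto simp: le_call_rel_def option_rel_def\<close>)
    ultimately show ?case
      by (simp add: p)
  qed
  then have "\<forall>q. q \<in> Wellfounded.acc (le_call_rel :: (('v \<times> 'v) \<times> _) set)"
    by (metis fst_conv snd_conv surj_pair)
  then show ?thesis
    by (rule acc_wfI)
qed

function conway_le :: "'v::zfc \<Rightarrow> 'v \<Rightarrow> bool" where
  "conway_le x y \<longleftrightarrow>
     (\<forall>l\<in>left_opts x. \<not> conway_le y l) \<and> (\<forall>r\<in>right_opts y. \<not> conway_le r x)"
  by auto
termination
  by (relation le_call_rel) (auto simp: wf_le_call_rel, auto simp: le_call_rel_def)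

declare conway_le.simps [simp del]

inductive number :: "'v::zfc \<Rightarrow> bool" where
  number: "(\<And>l. l \<in> elts L \<Longrightarrow> number l) \<Longrightarrow> (\<And>r. r \<in> elts R \<Longrightarrow> number r) \<Longrightarrow>
           (\<And>l r. l \<in> elts L \<Longrightarrow> r \<in> elts R \<Longrightarrow> \<not> conway_le r l) \<Longrightarrow>
           number (opair L R)"

lemma conway_le_refl: "conway_le x x"
proof (induction x rule: wf_induct_rule[OF wf_option_rel])
  case (1 x)
  have "\<not> conway_le x l" if "l \<in> left_opts x" for l
    using 1[OF left_option_rel[OF that]] that conway_le.simps[of x l] by blast
  moreover have "\<not> conway_le r x" if "r \<in> right_opts x" for r
    using 1[OF right_option_rel[OF that]] that conway_le.simps[of r x] by blast
  ultimately show ?case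
    by (subst conway_le.simps) blast
qed

lemma conway_le_trans:
  assumes "conway_le x y" and "conway_le y z"
  shows "conway_le x z"
proof -
  let ?T = "\<lambda>x y z :: 'a. conway_le x y \<longrightarrow> conway_le y z \<longrightarrow> conway_le x z"
  let ?S = "\<lambda>x y z :: 'a. ?T x y z \<and> ?T y z x \<and> ?T z x y"
  have T: "?T x y z"
    if "\<And>l. (l, x) \<in> option_rel \<Longrightarrow> ?S l y z" and "\<And>r. (r, z) \<in> option_rel \<Longrightarrow> ?S x y r"
    for x y z :: 'a
  proof (intro impI)
    assume xy: "conway_le x y" and yz: "conway_le y z"
    have "\<not> conway_le z l" if l: "l \<in> left_opts x" for l
      using \<open>\<And>l. (l, x) \<in> option_rel \<Longrightarrow> ?S l y z\<close>[OF left_option_rel[OF l]]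
        xy yz l conway_le.simps[of x y] by blast
    moreover have "\<not> conway_le r x" if r: "r \<in> right_opts z" for r
      using \<open>\<And>r. (r, z) \<in> option_rel \<Longrightarrow> ?S x y r\<close>[OF right_option_rel[OF r]]
        xy yz r conway_le.simps[of y z] by blast
    ultimately show "conway_le x z"
      by (subst conway_le.simps) blast
  qed
  have "?S x y z" for x y z :: 'a
  proof (induction x arbitrary: y z rule: wf_induct_rule[OF wf_option_rel])
    case x: (1 x)
    show ?case
    proof (induction y arbitrary: z rule: wf_induct_rule[OF wf_option_rel])
      case y: (1 y)
      show ?case
      proof (induction z rule: wf_induct_rule[OF wf_option_rel])
        case z: (1 z)
        show ?case
        proof (intro conjI)
          show "?T x y z"
            by (rule T) (use x[of _ y z] z in blast)+
          show "?T y z x"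
            by (rule T) (use y[of _ z] x[of _ y z] in blast)+
          show "?T z x y"
            by (rule T) (use z y[of _ z] in blast)+
        qed
      qed
    qed
  qed
  then show ?thesis
    using assms by blast
qed

lemma number_left_le: "number x \<Longrightarrow> l \<in> left_opts x \<Longrightarrow> conway_le l x"
  and number_right_le: "number x \<Longrightarrow> r \<in> right_opts x \<Longrightarrow> conway_le x r"
proof -
  have "(\<forall>l\<in>left_opts x. conway_le l x) \<and> (\<forall>r\<in>right_opts x. conway_le x r)"
    if "number x" for x :: 'a
    using that
  proof (induction x rule: number.induct)
    case (number L R)
    let ?x = "opair L R"
    have "conway_le l ?x" if l: "l \<in> elts L" for l
    proof -
      have "\<not> conway_le ?x ll" if "ll \<in> left_opts l" for ll
        using number.IH(1)[OF l] that l conway_le_trans[of ?x ll l] conway_le.simps[of ?x l]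
          conway_le_refl[of l] by auto
      then show ?thesis
        using number.hyps(3)[OF l] by (subst conway_le.simps) auto
    qed
    moreover have "conway_le ?x r" if r: "r \<in> elts R" for r
    proof -
      have "\<not> conway_le rr ?x" if "rr \<in> right_opts r" for rr
        using number.IH(2)[OF r] that r conway_le_trans[of r rr ?x] conway_le.simps[of r ?x]
          conway_le_refl[of r] by auto
      then show ?thesis
        using number.hyps(3)[OF _ r] by (subst conway_le.simps) auto
    qed
    ultimately show ?case
      by simp
  qed
  then show "number x \<Longrightarrow> l \<in> left_opts x \<Longrightarrow> conway_le l x"
    and "number x \<Longrightarrow> r \<in> right_opts x \<Longrightarrow> conway_le x r" for x l r :: 'a
    by blast+
qed

lemma number_linear:
  assumes "number x" and "number y"
  shows "conway_le x y \<or> conway_le y x"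
proof (cases "conway_le x y")
  case False
  then consider l where "l \<in> left_opts x" "conway_le y l" | r where "r \<in> right_opts y" "conway_le r x"
    using conway_le.simps[of x y] by blast
  then show ?thesis
  proof cases
    case 1
    then show ?thesis
      using conway_le_trans[OF 1(2) number_left_le[OF assms(1) 1(1)]] by simp
  next
    case 2
    then show ?thesis
      using conway_le_trans[OF number_right_le[OF assms(2) 2(1)] 2(2)] by simp
  qed
qed simp

lemma ex_number: "\<exists>x :: 'v::zfc. number x"
proof -
  obtain e :: 'v where "elts e = {}"
    using infinity by blast
  then have "number (opair e e)"
    by (intro number) auto
  then show ?thesis
    by blast
qed

text \<open>The class \<open>No\<close> is the whole type \<open>'v surreal\<close>, and its subclasses are the HOL sets over it.\<close>

quotient_type (overloaded) 'v surreal =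
  "'v::zfc" / partial: "\<lambda>x y. number x \<and> number y \<and> conway_le x y \<and> conway_le y x"
proof (rule part_equivpI)
  show "\<exists>x :: 'v. number x \<and> number x \<and> conway_le x x \<and> conway_le x x"
    using ex_number conway_le_refl by blast
  show "symp (\<lambda>x y :: 'v. number x \<and> number y \<and> conway_le x y \<and> conway_le y x)"
    by (rule sympI) blast
  show "transp (\<lambda>x y :: 'v. number x \<and> number y \<and> conway_le x y \<and> conway_le y x)"
    by (rule transpI) (meson conway_le_trans)
qed

instantiation surreal :: (zfc) linorder
begin

lift_definition less_eq_surreal :: "'a surreal \<Rightarrow> 'a surreal \<Rightarrow> bool" is conway_le
  by (meson conway_le_trans)

definition less_surreal :: "'a surreal \<Rightarrow> 'a surreal \<Rightarrow> bool" where
  "less_surreal x y \<longleftrightarrow> x \<le> y \<and> \<not> y \<le> x"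

instance
proof
  fix x y z :: "'a surreal"
  show "x < y \<longleftrightarrow> x \<le> y \<and> \<not> y \<le> x"
    by (rule less_surreal_def)
  show "x \<le> x"
    by transfer (rule conway_le_refl)
  show "x \<le> y \<Longrightarrow> y \<le> z \<Longrightarrow> x \<le> z"
    by transfer (rule conway_le_trans)
  show "x \<le> y \<Longrightarrow> y \<le> x \<Longrightarrow> x = y"
    by transfer blast
  show "x \<le> y \<or> y \<le> x"
    by transfer (simp add: number_linear)
qed

end

text \<open>
  \<open>'v surreal extended\<close> is the class of numbers together with the gaps \<open>Off = Minf\<close> and
  \<open>On = Pinf\<close>. The inclusions in \<open>interval_with_endpoints\<close> leave open which of the endpoints
  belong to the interval.
\<close>

definition interval_with_endpoints ::
    "'v::zfc surreal extended \<Rightarrow> 'v surreal extended \<Rightarrow> 'v surreal set \<Rightarrow> bool" where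
  "interval_with_endpoints a b A \<longleftrightarrow> {a<..<b} \<subseteq> Fin ` A \<and> Fin ` A \<subseteq> {a..b}"

definition open_interval :: "'v::zfc surreal set \<Rightarrow> bool" where
  "open_interval A \<longleftrightarrow> A \<noteq> {} \<and>
     (\<exists>a b. interval_with_endpoints a b A \<and> a \<notin> Fin ` A \<and> b \<notin> Fin ` A)"

definition open_class :: "'v::zfc surreal set \<Rightarrow> bool" where
  "open_class A \<longleftrightarrow> A = {} \<or> open_interval A \<or>
     (\<exists>(I::'v) S. (\<forall>i\<in>elts I. open_interval (S i)) \<and> A = (\<Union>i\<in>elts I. S i))"

text \<open>
  Index sets range over the universe. A collection of subclasses is a predicate on classes, and a
  subcollection indexed over a set \<open>I\<close> is a labelling of classes by the elements of \<open>I\<close>.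
\<close>

definition topology_on_No :: "('v::zfc surreal set \<Rightarrow> bool) \<Rightarrow> bool" where
  "topology_on_No \<A> \<longleftrightarrow>
     \<A> {} \<and> \<A> UNIV \<and>
     (\<forall>(I::'v) S. (\<forall>i\<in>elts I. \<A> (S i)) \<longrightarrow> \<A> (\<Union>i\<in>elts I. S i)) \<and>
     (\<forall>(I::'v) S. finite (elts I) \<longrightarrow> (\<forall>i\<in>elts I. \<A> (S i)) \<longrightarrow> \<A> (\<Inter>i\<in>elts I. S i))"

end

theory Submission
  imports Defs
begin

text \<open>
  The axioms reduce to two facts. First, a nonempty open interval consists of the numbers strictly
  between two endpoints, so two open intervals with endpoints \<open>a, b\<close> and \<open>c, d\<close> meet in the numbers
  strictly between \<open>max a c\<close> and \<open>min b d\<close>: the meet is empty or an open interval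
  (\<open>open_interval_Int\<close>), and its endpoints are again numbers, \<open>On\<close> or \<open>Off\<close>, being among the
  given ones.

  Secondly, the open classes are the unions of families of open intervals that can be indexed by a
  proper set (\<open>open_class_iff\<close>), and such families are closed under set-indexed unions
  (\<open>set_indexed_UN\<close>). The latter is where set theory enters: a union of families indexed by
  \<open>J i\<close>, with \<open>i\<close> ranging over \<open>I\<close>, is indexed by the disjoint sum of the \<open>J i\<close>, which is a proper
  set by replacement and union.

  A set-indexed union of open classes is then open at once. For two open classes \<open>\<Union>F\<close> and \<open>\<Union>G\<close>,
  distributivity gives \<open>\<Union>F \<inter> \<Union>G = (\<Union>A\<in>F. \<Union>B\<in>G. A \<inter> B)\<close>, and the nonempty ones among the classes
  \<open>A \<inter> B\<close> form a set-indexed family of open intervals. Finite intersections follow by induction,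
  starting from the empty intersection \<open>No\<close>, which is the interval from \<open>Off\<close> to \<open>On\<close>.
\<close>

text \<open>
  Indices are elements of the universe, whereas members of the family may be proper classes, so a
  family cannot itself be a set of the universe. Only the range of the labelling is recorded,
  since a union depends on nothing else.
\<close>

definition set_indexed :: "'v::zfc surreal set set \<Rightarrow> bool" where
  "set_indexed F \<longleftrightarrow> (\<exists>(I::'v) S. F = S ` elts I)"

lemma set_indexed_image_elts [simp]:
  fixes I :: "'v::zfc" and S :: "'v \<Rightarrow> 'v surreal set"
  shows "set_indexed (S ` elts I)"
  unfolding set_indexed_def by blast

lemma set_indexed_empty [simp]: "set_indexed ({} :: 'v::zfc surreal set set)"
proof -
  obtain e :: 'v where "elts e = {}"
    using infinity by blast
  then show ?thesis
    using set_indexed_image_elts[of _ e] by simp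
qed

lemma set_indexed_singleton [simp]: "set_indexed {A}"
  using set_indexed_image_elts[of "\<lambda>_. A" "set_of {undefined}"] by simp

lemma set_indexed_image:
  fixes f :: "'v::zfc surreal set \<Rightarrow> 'v surreal set"
  shows "set_indexed F \<Longrightarrow> set_indexed (f ` F)"
  by (auto simp: set_indexed_def[of F] image_image)

lemma set_indexed_filter:
  assumes "set_indexed (F :: 'v::zfc surreal set set)"
  shows "set_indexed {A \<in> F. P A}"
proof -
  obtain I :: 'v and S where F: "F = S ` elts I"
    using assms unfolding set_indexed_def by blast
  obtain J where "elts J = {i \<in> elts I. P (S i)}"
    using separation[of I "\<lambda>i. P (S i)"] by blast
  then have "{A \<in> F. P A} = S ` elts J"
    by (auto simp: F)
  then show ?thesis
    by simp
qed

lemma ex_disjoint_sum: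
  fixes I :: "'v::zfc"
  shows "\<exists>K. elts K = {opair i j | i j. i \<in> elts I \<and> j \<in> elts (J i)}"
proof -
  have "\<forall>i. \<exists>z. elts z = opair i ` elts (J i)"
    by (intro allI replacement)
  from choice[OF this] obtain f where f: "\<And>i. elts (f i) = opair i ` elts (J i)"
    by blast
  obtain M where M: "elts M = f ` elts I"
    using replacement[of f I] by blast
  obtain K where "elts K = (\<Union>y\<in>elts M. elts y)"
    using union[of M] by blast
  then have "elts K = {opair i j | i j. i \<in> elts I \<and> j \<in> elts (J i)}"
    by (auto simp: M f)
  then show ?thesis ..
qed

text \<open>
  An indexing is chosen for every \<open>T A\<close> at once. As different \<open>T A\<close> may use the same index for
  different classes, the union is labelled by pairs.
\<close>

lemma set_indexed_UN:
  assumes F: "set_indexed (F :: 'v::zfc surreal set set)"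
    and T: "\<And>A. A \<in> F \<Longrightarrow> set_indexed (T A :: 'v surreal set set)"
  shows "set_indexed (\<Union>A\<in>F. T A)"
proof -
  obtain I :: 'v and S where F: "F = S ` elts I"
    using F unfolding set_indexed_def by blast
  have "\<forall>A\<in>F. \<exists>(J::'v) U. T A = U ` elts J"
    using T unfolding set_indexed_def by blast
  then obtain J :: "'v surreal set \<Rightarrow> 'v" and U where U: "T A = U A ` elts (J A)" if "A \<in> F" for A
    by metis
  obtain K where K: "elts K = {opair i j | i j. i \<in> elts I \<and> j \<in> elts (J (S i))}"
    using ex_disjoint_sum[of I "\<lambda>i. J (S i)"] by blast
  have inj: "inj (\<lambda>(i, j). opair i j :: 'v)"
    by (auto simp: inj_def)
  define V where "V k = (case inv (\<lambda>(i, j). opair i j) k of (i, j) \<Rightarrow> U (S i) j)" for k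
  have V: "V (opair i j) = U (S i) j" for i j
    using inv_f_f[OF inj, of "(i, j)"] by (simp add: V_def)
  have "(\<Union>A\<in>F. T A) = (\<Union>i\<in>elts I. U (S i) ` elts (J (S i)))"
    by (simp add: F U)
  also have "\<dots> = V ` elts K"
    by (force simp: K V[symmetric])
  finally show ?thesis
    by simp
qed

lemma open_interval_iff:
  "open_interval A \<longleftrightarrow> A \<noteq> {} \<and> (\<exists>a b. A = {x. a < Fin x \<and> Fin x < b})"
proof -
  have "interval_with_endpoints a b A \<and> a \<notin> Fin ` A \<and> b \<notin> Fin ` A \<longleftrightarrow>
        A = {x. a < Fin x \<and> Fin x < b}" if ne: "A \<noteq> {}" for a b
  proof
    assume L: "interval_with_endpoints a b A \<and> a \<notin> Fin ` A \<and> b \<notin> Fin ` A"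
    show "A = {x. a < Fin x \<and> Fin x < b}"
    proof (intro set_eqI iffI)
      fix x
      assume "x \<in> A"
      then have "Fin x \<in> {a..b}" and "Fin x \<noteq> a" and "Fin x \<noteq> b"
        using L unfolding interval_with_endpoints_def by blast+
      then show "x \<in> {x. a < Fin x \<and> Fin x < b}"
        by auto
    next
      fix x
      assume "x \<in> {x. a < Fin x \<and> Fin x < b}"
      then have "Fin x \<in> Fin ` A"
        using L unfolding interval_with_endpoints_def by auto
      then show "x \<in> A"
        by auto
    qed
  next
    assume A: "A = {x. a < Fin x \<and> Fin x < b}"
    obtain x where x: "a < Fin x" "Fin x < b"
      using ne A by blast
    have "y \<in> Fin ` A" if "a < y" "y < b" for y
      using that by (cases y) (auto simp: A)
    then have "interval_with_endpoints a b A"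
      unfolding interval_with_endpoints_def by (auto simp: A less_imp_le)
    then show "interval_with_endpoints a b A \<and> a \<notin> Fin ` A \<and> b \<notin> Fin ` A"
      by (auto simp: A)
  qed
  then show ?thesis
    unfolding open_interval_def by blast
qed

lemma open_interval_UNIV: "open_interval UNIV"
proof -
  have "UNIV = {x :: 'a surreal. Minf < Fin x \<and> Fin x < Pinf}"
    by simp
  then show ?thesis
    unfolding open_interval_iff by blast
qed

lemma open_interval_Int:
  assumes "open_interval A" and "open_interval B" and "A \<inter> B \<noteq> {}"
  shows "open_interval (A \<inter> B)"
proof -
  obtain a b c d where "A = {x. a < Fin x \<and> Fin x < b}" and "B = {x. c < Fin x \<and> Fin x < d}"
    using assms(1,2) unfolding open_interval_iff by blast
  then have "A \<inter> B = {x. max a c < Fin x \<and> Fin x < min b d}"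
    by auto
  then show ?thesis
    using assms(3) unfolding open_interval_iff by blast
qed

text \<open>
  The empty class and the single intervals, listed separately in the definition, are the unions of
  the families indexed by the empty set and by a singleton.
\<close>

lemma open_class_iff:
  "open_class A \<longleftrightarrow> (\<exists>F. set_indexed F \<and> (\<forall>B\<in>F. open_interval B) \<and> A = \<Union>F)"
proof
  assume "open_class A"
  then consider "A = {}" | "open_interval A"
    | (union) I S where "\<forall>i\<in>elts (I::'a). open_interval (S i)" "A = (\<Union>i\<in>elts I. S i)"
    unfolding open_class_def by blast
  then show "\<exists>F. set_indexed F \<and> (\<forall>B\<in>F. open_interval B) \<and> A = \<Union>F"
  proof cases
    case 1
    then show ?thesis
      by (intro exI[of _ "{}"]) simp
  next
    case 2
    then show ?thesis
      by (intro exI[of _ "{A}"]) simp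
  next
    case union
    then show ?thesis
      by (intro exI[of _ "S ` elts I"]) simp
  qed
next
  assume "\<exists>F. set_indexed F \<and> (\<forall>B\<in>F. open_interval B) \<and> A = \<Union>F"
  then show "open_class A"
    unfolding open_class_def set_indexed_def by blast
qed

lemma open_class_UN:
  fixes I :: "'v::zfc" and S :: "'v \<Rightarrow> 'v surreal set"
  assumes "\<And>i. i \<in> elts I \<Longrightarrow> open_class (S i)"
  shows "open_class (\<Union>i\<in>elts I. S i)"
proof -
  have "\<forall>A\<in>S ` elts I. \<exists>F. set_indexed F \<and> (\<forall>B\<in>F. open_interval B) \<and> A = \<Union>F"
    using assms by (simp add: open_class_iff)
  from bchoice[OF this] obtain T
    where T: "\<forall>A\<in>S ` elts I. set_indexed (T A) \<and> (\<forall>B\<in>T A. open_interval B) \<and> A = \<Union>(T A)" ..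
  have "set_indexed (\<Union>A\<in>S ` elts I. T A)"
    using T by (intro set_indexed_UN) auto
  moreover have "\<forall>B\<in>(\<Union>A\<in>S ` elts I. T A). open_interval B"
    using T by blast
  moreover have "(\<Union>i\<in>elts I. S i) = \<Union>(\<Union>A\<in>S ` elts I. T A)"
  proof -
    have "(\<Union>A\<in>S ` elts I. A) = (\<Union>A\<in>S ` elts I. \<Union>(T A))"
      by (rule SUP_cong[OF refl]) (use T in blast)
    then show ?thesis
      by blast
  qed
  ultimately show ?thesis
    unfolding open_class_iff by blast
qed

lemma open_class_Int:
  assumes "open_class A" and "open_class B"
  shows "open_class (A \<inter> B)"
proof -
  obtain F G where F: "set_indexed F" "\<forall>C\<in>F. open_interval C" "A = \<Union>F"
    and G: "set_indexed G" "\<forall>D\<in>G. open_interval D" "B = \<Union>G"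
    using assms unfolding open_class_iff by blast
  \<comment> \<open>The empty class is not an open interval, so disjoint pairs have to be left out.\<close>
  define H where "H = {E \<in> (\<Union>C\<in>F. (\<inter>) C ` G). E \<noteq> {}}"
  have "set_indexed H"
    unfolding H_def by (intro set_indexed_filter set_indexed_UN set_indexed_image F(1) G(1))
  moreover have "\<forall>E\<in>H. open_interval E"
    using F(2) G(2) open_interval_Int unfolding H_def by blast
  moreover have "A \<inter> B = \<Union>H"
    unfolding F(3) G(3) H_def by blast
  ultimately show ?thesis
    unfolding open_class_iff by blast
qed

lemma open_class_UNIV: "open_class UNIV"
  unfolding open_class_def using open_interval_UNIV by blast

lemma open_class_INT:
  assumes "finite X" and "\<And>i. i \<in> X \<Longrightarrow> open_class (S i)"
  shows "open_class (\<Inter>i\<in>X. S i)"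
  using assms by (induction X rule: finite_induct) (auto intro: open_class_Int open_class_UNIV)

theorem proposition9:
  shows "topology_on_No (open_class :: 'v::zfc surreal set \<Rightarrow> bool)"
  unfolding topology_on_No_def
proof (intro conjI allI impI)
  show "open_class {}"
    by (simp add: open_class_def)
qed (auto intro: open_class_UNIV open_class_UN open_class_INT)

end
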